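(* Let $g\colon\mathbb{R}^d\to\mathbb{R}^d$ be Lipschitz continuous and let $\mathcal{E}\in C^1(\mathbb{R}^d;[0,+\infty))$ be such that $\mathcal{E}(0)=\min_{x\in\mathbb{R}^d}\mathcal{E}(x)$ and such that there exist $c_1>0$ and $\gamma>0$ with $$|\nabla\mathcal{E}(x)|\le c_1(1+\|x\|^\gamma)\qquad\text{for every }x\in\mathbb{R}^d.$$ Assume moreover that either of the following two conditions is fulfilled: (i) there exist $c_2,c_3>0$ and $\nu\ge0$ such that $c_2\|x\|^\nu\le\mathcal{E}(x)\le c_3(1+\|x\|^\nu)$ for every $x\in\mathbb{R}^d$; (ii) $g$ is bounded in $\mathbb{R}^d$ and there exist $c_2>0$ and $\nu>0$ such that $\mathcal{E}(x)\ge c_2\|x\|^\nu$ for every $x\in\mathbb{R}^d$. For $n\in\mathbb{N}$ and $\mu\in\mathcal{P}_1(\mathbb{R}^d)$ let $$f_n(\mu)=\frac{1}{\|\omega_n\|_{L^1_\mu}}\int_{\mathbb{R}^d}g(x)e^{-n\mathcal{E}(x)}\,d\mu(x),\qquad \omega_n(x)=e^{-n\mathcal{E}(x)}.$$ Then there exist $M\ge0$ and, for every $n\in\mathbb{N}$ and $R>0$, a constant $L_{n,R}>0$ such that for every $\mu,\mu_1,\mu_2\in\mathcal{P}_1(\mathbb{R}^d)$ with $m_1(\mu_i)\le R$ for $i=1,2$, $$\|f_n(\mu_1)-f_n(\mu_2)\|\le L_{n,R}\,W_1(\mu_1,\mu_2),\qquad \|f_n(\mu)\|\le M(1+m_1(\mu)).$$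 In particular, $f_n$ satisfies conditions (f1) and (f2) (see context) for every $n$, and the constant $M_{f_n}$ in (f2) can be chosen to be independent of $n\in\mathbb{N}$.
   Context: $\|\cdot\|$ is the Euclidean norm on $\mathbb{R}^d$, $d>1$, and $|\nabla\mathcal{E}(x)|$ is the Euclidean length of the gradient; $\mathcal{P}_1(\mathbb{R}^d)$ is the set of probability measures $\mu$ on $\mathbb{R}^d$ with $m_1(\mu)=\int_{\mathbb{R}^d}\|x\|\,d\mu(x)<+\infty$; $W_1$ is the 1-Wasserstein distance; $\|\omega_n\|_{L^1_\mu}=\int_{\mathbb{R}^d}\omega_n\,d\mu$. For a map $f\colon\mathcal{P}_1(\mathbb{R}^d)\to\mathbb{R}^d$ the conditions are: (f1) for every $R>0$ there exists $L_{f,R}>0$ such that $\|f(\mu_1)-f(\mu_2)\|\le L_{f,R}W_1(\mu_1,\mu_2)$ for all $\mu_1,\mu_2\in\mathcal{P}_1(\mathbb{R}^d)$ with $m_1(\mu_1),m_1(\mu_2)\le R$; (f2) there exists $M_f\ge0$ such that $\|f(\mu)\|\le M_f(1+m_1(\mu))$ for all $\mu\in\mathcal{P}_1(\mathbb{R}^d)$.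
   Formalization: In condition (i) the exponent is required to satisfy ν>0 instead of ν≥0; for ν=0 the claim is false, since for g=id and a suitable bounded E no constant M independent of n exists. *)

theory Defs
  imports "HOL-Probability.Probability"
begin

definition P1 :: "'a::euclidean_space measure set" where
  "P1 = {\<mu>. prob_space \<mu> \<and> sets \<mu> = sets borel \<and> integrable \<mu> (\<lambda>x. norm x)}"

definition m1 :: "'a::euclidean_space measure \<Rightarrow> real" where
  "m1 \<mu> = (\<integral>x. norm x \<partial>\<mu>)"

definition couplings ::
  "'a::euclidean_space measure \<Rightarrow> 'a measure \<Rightarrow> ('a \<times> 'a) measure set" where
  "couplings \<mu> \<nu> = {\<pi>. prob_space \<pi> \<and> sets \<pi> = sets borel \<and>
     distr \<pi> borel fst = \<mu> \<and> distr \<pi> borel snd = \<nu>}"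

(* The infimum is taken in ennreal; it is finite for measures in P1, so enn2real
   (which sends infinity to 0) loses nothing there. *)
definition W1 :: "'a::euclidean_space measure \<Rightarrow> 'a measure \<Rightarrow> real" where
  "W1 \<mu> \<nu> = enn2real (INF \<pi>\<in>couplings \<mu> \<nu>. \<integral>\<^sup>+z. ennreal (dist (fst z) (snd z)) \<partial>\<pi>)"

definition cond_f1 :: "('a::euclidean_space measure \<Rightarrow> 'a) \<Rightarrow> bool" where
  "cond_f1 f \<longleftrightarrow> (\<forall>R>0. \<exists>L>0. \<forall>\<mu>1\<in>P1. \<forall>\<mu>2\<in>P1. m1 \<mu>1 \<le> R \<longrightarrow> m1 \<mu>2 \<le> R \<longrightarrow>
     norm (f \<mu>1 - f \<mu>2) \<le> L * W1 \<mu>1 \<mu>2)"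

definition cond_f2_with :: "real \<Rightarrow> ('a::euclidean_space measure \<Rightarrow> 'a) \<Rightarrow> bool" where
  "cond_f2_with M f \<longleftrightarrow> (\<forall>\<mu>\<in>P1. norm (f \<mu>) \<le> M * (1 + m1 \<mu>))"

definition cond_f2 :: "('a::euclidean_space measure \<Rightarrow> 'a) \<Rightarrow> bool" where
  "cond_f2 f \<longleftrightarrow> (\<exists>M\<ge>0. cond_f2_with M f)"

definition gibbs_weight :: "('a::euclidean_space \<Rightarrow> real) \<Rightarrow> nat \<Rightarrow> 'a \<Rightarrow> real" where
  "gibbs_weight \<E> n x = exp (- real n * \<E> x)"

definition gibbs_mean ::
  "('a::euclidean_space \<Rightarrow> 'a) \<Rightarrow> ('a \<Rightarrow> real) \<Rightarrow> nat \<Rightarrow> 'a measure \<Rightarrow> 'a" where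
  "gibbs_mean g \<E> n \<mu> =
     (1 / (\<integral>x. gibbs_weight \<E> n x \<partial>\<mu>)) *\<^sub>R (\<integral>x. gibbs_weight \<E> n x *\<^sub>R g x \<partial>\<mu>)"

(* Condition (i) needs nu > 0: the result is false for nu = 0. Take g = id and a C^1 function E with bounded gradient, values
   in [1,2], and E(a) = 2 > 1 = E(0) = E(b) for all large norm b. For
   mu = (1 - e) delta_a + e delta_b with e = exp(-n) and norm b = exp n, the moment m1 mu is
   at most norm a + 1, but the mean is ((1 - e) a + b) / (2 - e), of norm at least
   (exp n - norm a) / 2, so no M is independent of n. *)
definition growth_i :: "('a::euclidean_space \<Rightarrow> real) \<Rightarrow> bool" where
  "growth_i \<E> \<longleftrightarrow> (\<exists>c2>0. \<exists>c3>0. \<exists>\<nu>>0. \<forall>x.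
     c2 * norm x powr \<nu> \<le> \<E> x \<and> \<E> x \<le> c3 * (1 + norm x powr \<nu>))"

definition growth_ii :: "('a::euclidean_space \<Rightarrow> 'a) \<Rightarrow> ('a \<Rightarrow> real) \<Rightarrow> bool" where
  "growth_ii g \<E> \<longleftrightarrow> bounded (range g) \<and> (\<exists>c2>0. \<exists>\<nu>>0. \<forall>x. c2 * norm x powr \<nu> \<le> \<E> x)"

end

theory Submission
  imports Defs "HOL-Real_Asymp.Real_Asymp"
begin

text \<open>Since \<open>\<E>\<close> grows at least like a power of \<open>norm x\<close> and its gradient at most like one, both
  \<open>\<omega> = exp (- n \<E>)\<close> and \<open>\<omega> g\<close> are globally Lipschitz for each fixed \<open>n\<close>, so their integrals are
  Lipschitz in \<open>\<mu>\<close> with respect to \<open>W1\<close>. The normalising constant is bounded below on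
  \<open>m1 \<mu> \<le> R\<close> by Markov's inequality, hence the quotient is Lipschitz there as well. The growth bound
  uniform in \<open>n\<close> is immediate for bounded \<open>g\<close>; under two-sided growth of \<open>\<E>\<close> it holds because the
  weight outside a ball of radius proportional to \<open>1 + m1 \<mu>\<close> is dominated by the normalising
  constant.\<close>

section \<open>Global Lipschitz bounds from pointwise estimates, and decay of exponentials\<close>

text \<open>The local bounds give continuity, and along the segment from \<open>x\<close> to
  \<open>y\<close> they let every parameter \<open>t\<close> advance a little with slope at most
  \<open>L * norm (y - x)\<close>. For a continuous curve this already forces the Lipschitz bound on
  the whole segment, with no loss in the constant. The neighbourhood may depend on the base point,
  which is what a derivative at a single point provides.\<close>

lemma lipschitz_on_UNIV_if_eventually:
  fixes f :: "'a::real_normed_vector \<Rightarrow> 'b::metric_space"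
  assumes L: "L \<ge> 0"
    and loc: "\<And>x. \<forall>\<^sub>F y in nhds x. dist (f y) (f x) \<le> L * dist y x"
  shows "L-lipschitz_on UNIV f"
proof (rule lipschitz_onI[OF _ L])
  have cont: "isCont f x" for x
  proof -
    have "((\<lambda>y. dist (f y) (f x)) \<longlongrightarrow> 0) (at x)"
    proof (rule tendsto_sandwich[of "\<lambda>_. 0"])
      show "\<forall>\<^sub>F y in at x. dist (f y) (f x) \<le> L * dist y x"
        using loc[of x] by (auto simp: eventually_at_filter elim: eventually_mono)
      show "((\<lambda>y. L * dist y x) \<longlongrightarrow> 0) (at x)"
        by (auto intro!: tendsto_eq_intros)
    qed auto
    then show ?thesis
      unfolding isCont_def by (subst tendsto_dist_iff)
  qed
  fix x y :: 'a
  define p where "p t = x + t *\<^sub>R (y - x)" for t :: real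
  have "(L * norm (y - x))-lipschitz_on {0..1} (f \<circ> p)"
  proof (rule locally_lipschitz_imp_lipschitz)
    show "continuous_on {0..1} (f \<circ> p)"
      unfolding o_def p_def
      by (rule continuous_on_compose2[OF continuous_at_imp_continuous_on])
        (use cont in \<open>auto intro!: continuous_intros\<close>)
    fix t s :: real
    assume "t \<in> {0..<1}" "s > t"
    obtain d where d: "d > 0" "\<And>z. dist z (p t) < d \<Longrightarrow> dist (f z) (f (p t)) \<le> L * dist z (p t)"
      using loc[of "p t"] unfolding eventually_nhds_metric by blast
    \<comment> \<open>The offset keeps \<open>p z\<close> within distance \<open>d\<close> of
      \<open>p t\<close>; the \<open>+ 1\<close> in the denominator covers \<open>y = x\<close>, and
      the minimum keeps \<open>z\<close> below \<open>s\<close>.\<close>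
    define z where "z = min s (t + d / (norm (y - x) + 1))"
    have z: "t < z" "z \<le> s"
      using d(1) \<open>s > t\<close> by (auto simp: z_def add_nonneg_pos)
    have "p z - p t = (z - t) *\<^sub>R (y - x)"
      by (simp add: p_def algebra_simps)
    then have dz: "dist (p z) (p t) = (z - t) * norm (y - x)"
      using z by (simp add: dist_norm)
    also have "\<dots> < (z - t) * (norm (y - x) + 1)"
      using z by simp
    also have "\<dots> \<le> d / (norm (y - x) + 1) * (norm (y - x) + 1)"
      by (intro mult_right_mono) (auto simp: z_def)
    also have "\<dots> = d"
      by (simp add: add_nonneg_eq_0_iff)
    finally have "dist (f (p z)) (f (p t)) \<le> L * dist (p z) (p t)"
      by (rule d(2))
    then show "\<exists>z\<in>{t<..s}. dist ((f \<circ> p) z) ((f \<circ> p) t) \<le> L * norm (y - x) * (z - t)"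
      using z dz by (intro bexI[of _ z]) (auto simp: mult_ac)
  qed (use L in simp)
  from lipschitz_onD[OF this, of 0 1] show "dist (f x) (f y) \<le> L * dist x y"
    by (simp add: p_def dist_norm norm_minus_commute)
qed

text \<open>A product rule for a factor \<open>g\<close> that is only Lipschitz. Splitting the
  increment as \<open>w y *\<^sub>R (g y - g x) + (w y - w x) *\<^sub>R g x\<close> puts
  \<open>g\<close> in the second term at the point where the gradient of \<open>w\<close> is taken,
  so an unbounded \<open>g\<close> is harmless as long as the gradient decays fast enough. The
  summand \<open>1\<close> absorbs the remainder of the first-order expansion of
  \<open>w\<close>.\<close>

lemma lipschitz_scaleR_GDERIV:
  fixes w :: "'a::real_inner \<Rightarrow> real" and g :: "'a \<Rightarrow> 'b::real_normed_vector"
  assumes w: "\<And>x. GDERIV w x :> w' x" "\<And>x. \<bar>w x\<bar> \<le> 1"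
    and g: "K-lipschitz_on UNIV g"
    and B: "\<And>x. norm (w' x) * norm (g x) \<le> B"
  shows "(K + B + 1)-lipschitz_on UNIV (\<lambda>x. w x *\<^sub>R g x)"
proof (rule lipschitz_on_UNIV_if_eventually)
  have "0 \<le> norm (w' 0) * norm (g 0)"
    by simp
  also have "\<dots> \<le> B"
    by (rule B)
  finally show "0 \<le> K + B + 1"
    using lipschitz_on_nonneg[OF g] by simp
  fix x
  \<comment> \<open>Precision chosen so that the remainder, once multiplied by
    \<open>norm (g x)\<close>, is at most \<open>norm (y - x)\<close>.\<close>
  define e where "e = 1 / (1 + norm (g x))"
  have e: "e > 0"
    by (simp add: e_def add_pos_nonneg)
  have eg: "e * norm (g x) \<le> 1"
    by (simp add: e_def divide_simps add_nonneg_eq_0_iff add_pos_nonneg)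
  obtain d where d: "d > 0"
    "\<And>y. norm (y - x) < d \<Longrightarrow> norm (w y - w x - (y - x) \<bullet> w' x) \<le> e * norm (y - x)"
    using w(1)[of x] e unfolding gderiv_def has_derivative_at_alt by blast
  have "dist (w y *\<^sub>R g y) (w x *\<^sub>R g x) \<le> (K + B + 1) * dist y x" if "dist y x < d" for y
  proof -
    have "\<bar>w y - w x\<bar> \<le> e * norm (y - x) + \<bar>(y - x) \<bullet> w' x\<bar>"
      using d(2)[of y] that by (simp add: dist_norm)
    also have "\<dots> \<le> e * norm (y - x) + norm (y - x) * norm (w' x)"
      using Cauchy_Schwarz_ineq2 by (intro add_left_mono)
    finally have "\<bar>w y - w x\<bar> * norm (g x) \<le> (e * norm (y - x) + norm (y - x) * norm (w' x)) * norm (g x)"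
      by (intro mult_right_mono) auto
    also have "\<dots> = (e * norm (g x) + norm (w' x) * norm (g x)) * norm (y - x)"
      by (simp add: algebra_simps)
    also have "\<dots> \<le> (1 + B) * norm (y - x)"
      using eg B[of x] by (intro mult_right_mono add_mono) auto
    finally have 1: "\<bar>w y - w x\<bar> * norm (g x) \<le> (1 + B) * norm (y - x)" .
    have "\<bar>w y\<bar> * norm (g y - g x) \<le> 1 * norm (g y - g x)"
      using w(2)[of y] by (intro mult_right_mono) auto
    also have "\<dots> \<le> K * norm (y - x)"
      using lipschitz_onD[OF g, of y x] by (simp add: dist_norm)
    finally have 2: "\<bar>w y\<bar> * norm (g y - g x) \<le> K * norm (y - x)" .
    have "w y *\<^sub>R g y - w x *\<^sub>R g x = w y *\<^sub>R (g y - g x) + (w y - w x) *\<^sub>R g x"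
      by (simp add: algebra_simps)
    then have "norm (w y *\<^sub>R g y - w x *\<^sub>R g x) \<le> \<bar>w y\<bar> * norm (g y - g x) + \<bar>w y - w x\<bar> * norm (g x)"
      using norm_triangle_ineq[of "w y *\<^sub>R (g y - g x)" "(w y - w x) *\<^sub>R g x"] by simp
    with 1 2 show ?thesis
      by (simp add: dist_norm algebra_simps)
  qed
  with d(1) show "\<forall>\<^sub>F y in nhds x. dist (w y *\<^sub>R g y) (w x *\<^sub>R g x) \<le> (K + B + 1) * dist y x"
    unfolding eventually_nhds_metric by blast
qed

text \<open>Meant for \<open>t = norm x\<close>: the first factor models the gradient of the energy,
  the second the linear growth of a Lipschitz function, and the exponential the weight, which beats
  both.\<close>

lemma powr_mult_exp_powr_bounded:
  fixes a c \<nu> :: real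
  assumes "a > 0" "c > 0" "\<nu> > 0"
  shows "\<exists>B. \<forall>t\<ge>0. (1 + t powr a) * (1 + t) * exp (- (c * t powr \<nu>)) \<le> B"
proof -
  have "((\<lambda>t. (1 + t powr a) * (1 + t) * exp (- (c * t powr \<nu>))) \<longlongrightarrow> 0) at_top"
    using assms by real_asymp
  then have "\<forall>\<^sub>F t in at_top. (1 + t powr a) * (1 + t) * exp (- (c * t powr \<nu>)) < 1"
    by (rule order_tendstoD) simp
  then obtain T where T: "\<And>t. t \<ge> T \<Longrightarrow> (1 + t powr a) * (1 + t) * exp (- (c * t powr \<nu>)) < 1"
    unfolding eventually_at_top_linorder by blast
  \<comment> \<open>Beyond \<open>T\<close> the limit gives the bound 1; on \<open>[0, T)\<close>
    both polynomial factors are monotone and the exponential is at most 1.\<close>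
  have "(1 + t powr a) * (1 + t) * exp (- (c * t powr \<nu>))
      \<le> max 1 ((1 + T powr a) * (1 + T) * 1)" if t: "t \<ge> 0" for t
  proof (cases "t \<ge> T")
    case True
    then show ?thesis
      using T[of t] by auto
  next
    case False
    then have "(1 + t powr a) * (1 + t) * exp (- (c * t powr \<nu>)) \<le> (1 + T powr a) * (1 + T) * 1"
      using t assms by (intro mult_mono add_mono powr_mono2) auto
    then show ?thesis
      by linarith
  qed
  then show ?thesis
    by blast
qed

section \<open>Measures with finite first moment, couplings and the distance
  \<open>W1\<close>\<close>

lemma P1D:
  assumes "\<mu> \<in> P1"
  shows "prob_space \<mu>" "sets \<mu> = sets borel" "integrable \<mu> (\<lambda>x. norm x)"
  using assms by (auto simp: P1_def)

lemma m1_nonneg: "m1 \<mu> \<ge> 0"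
  by (simp add: m1_def)

lemma P1_integrable_linear_growth:
  fixes h :: "'a::euclidean_space \<Rightarrow> 'b::{banach, second_countable_topology}"
  assumes \<mu>: "\<mu> \<in> P1" and "continuous_on UNIV h" and "\<And>x. norm (h x) \<le> a + b * norm x"
  shows "integrable \<mu> h"
proof -
  interpret prob_space \<mu>
    by (rule P1D[OF \<mu>])
  have [measurable_cong]: "sets \<mu> = sets borel"
    by (rule P1D[OF \<mu>])
  have [measurable]: "h \<in> borel_measurable borel"
    by (rule borel_measurable_continuous_onI) fact
  have "integrable \<mu> (\<lambda>x. a + b * norm x)"
    using P1D(3)[OF \<mu>] by auto
  then show ?thesis
    by (rule Bochner_Integration.integrable_bound)
      (use assms(3) order_trans[OF _ abs_ge_self] in auto)
qed

lemma lipschitz_linear_growth: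
  fixes h :: "'a::real_normed_vector \<Rightarrow> 'b::real_normed_vector"
  assumes "L-lipschitz_on UNIV h"
  shows "norm (h x) \<le> norm (h 0) + L * norm x"
  using lipschitz_onD[OF assms, of x 0] norm_triangle_ineq2[of "h x" "h 0"]
  by (simp add: dist_norm)

lemma P1_integrable_lipschitz:
  fixes h :: "'a::euclidean_space \<Rightarrow> 'b::{banach, second_countable_topology}"
  assumes "\<mu> \<in> P1" and h: "L-lipschitz_on UNIV h"
  shows "integrable \<mu> h"
  using assms(1) lipschitz_on_continuous_on[OF h] lipschitz_linear_growth[OF h]
  by (rule P1_integrable_linear_growth)

text \<open>Guarantees that the infimum defining \<open>W1\<close> runs over a nonempty set; an
  empty one would yield infinity, which \<open>enn2real\<close> turns into 0.\<close>

lemma pair_measure_in_couplings: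
  assumes "\<mu> \<in> P1" "\<nu> \<in> P1"
  shows "\<mu> \<Otimes>\<^sub>M \<nu> \<in> couplings \<mu> \<nu>"
proof -
  interpret A: prob_space \<mu>
    by (rule P1D) fact
  interpret B: prob_space \<nu>
    by (rule P1D) fact
  interpret pair_prob_space \<mu> \<nu> ..
  have [measurable_cong]: "sets \<mu> = sets borel" "sets \<nu> = sets borel"
    by (fact P1D(2)[OF assms(1)] P1D(2)[OF assms(2)])+
  have sp: "space \<mu> = UNIV" "space \<nu> = UNIV"
    using assms[THEN P1D(2), THEN sets_eq_imp_space_eq] by auto
  have "sets (\<mu> \<Otimes>\<^sub>M \<nu>) = sets (borel \<Otimes>\<^sub>M borel)"
    using assms by (intro sets_pair_measure_cong P1D)
  then have sets: "sets (\<mu> \<Otimes>\<^sub>M \<nu>) = sets borel"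
    unfolding borel_prod .
  have "distr (\<mu> \<Otimes>\<^sub>M \<nu>) borel fst = \<mu>"
  proof (rule measure_eqI)
    fix X :: "'a set"
    assume "X \<in> sets (distr (\<mu> \<Otimes>\<^sub>M \<nu>) borel fst)"
    then have X: "X \<in> sets borel"
      by simp
    have "fst -` X \<inter> space (\<mu> \<Otimes>\<^sub>M \<nu>) = X \<times> space \<nu>"
      by (auto simp: space_pair_measure sp)
    then show "emeasure (distr (\<mu> \<Otimes>\<^sub>M \<nu>) borel fst) X = emeasure \<mu> X"
      using X assms[THEN P1D(2)]
      by (simp add: emeasure_distr B.emeasure_pair_measure_Times[OF _ sets.top] B.emeasure_space_1)
  qed (use assms in \<open>simp add: P1D\<close>)
  moreover have "distr (\<mu> \<Otimes>\<^sub>M \<nu>) borel snd = \<nu>"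
  proof (rule measure_eqI)
    fix X :: "'a set"
    assume "X \<in> sets (distr (\<mu> \<Otimes>\<^sub>M \<nu>) borel snd)"
    then have X: "X \<in> sets borel"
      by simp
    have "snd -` X \<inter> space (\<mu> \<Otimes>\<^sub>M \<nu>) = space \<mu> \<times> X"
      by (auto simp: space_pair_measure sp)
    then show "emeasure (distr (\<mu> \<Otimes>\<^sub>M \<nu>) borel snd) X = emeasure \<nu> X"
      using X assms[THEN P1D(2)]
      by (simp add: emeasure_distr B.emeasure_pair_measure_Times[OF sets.top] A.emeasure_space_1)
  qed (use assms in \<open>simp add: P1D\<close>)
  ultimately show ?thesis
    using sets prob_space_axioms by (auto simp: couplings_def)
qed

lemma couplings_integral:
  fixes h :: "'a::euclidean_space \<Rightarrow> 'b::{banach, second_countable_topology}"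
  assumes \<pi>: "\<pi> \<in> couplings \<mu> \<nu>" and h: "integrable \<mu> h" "integrable \<nu> h"
    and [measurable]: "h \<in> borel_measurable borel"
  shows "integrable \<pi> (\<lambda>z. h (fst z))" "integrable \<pi> (\<lambda>z. h (snd z))"
    and "(\<integral>z. h (fst z) \<partial>\<pi>) = (\<integral>x. h x \<partial>\<mu>)" "(\<integral>z. h (snd z) \<partial>\<pi>) = (\<integral>x. h x \<partial>\<nu>)"
proof -
  have "sets \<pi> = sets (borel \<Otimes>\<^sub>M borel)"
    using \<pi> unfolding borel_prod by (simp add: couplings_def)
  note [measurable_cong] = this
  have \<mu>: "\<mu> = distr \<pi> borel fst" and \<nu>: "\<nu> = distr \<pi> borel snd"
    using \<pi> by (auto simp: couplings_def)
  show "integrable \<pi> (\<lambda>z. h (fst z))"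
    using h(1) unfolding \<mu> by (subst (asm) integrable_distr_eq) auto
  show "integrable \<pi> (\<lambda>z. h (snd z))"
    using h(2) unfolding \<nu> by (subst (asm) integrable_distr_eq) auto
  show "(\<integral>z. h (fst z) \<partial>\<pi>) = (\<integral>x. h x \<partial>\<mu>)"
    unfolding \<mu> by (subst integral_distr) auto
  show "(\<integral>z. h (snd z) \<partial>\<pi>) = (\<integral>x. h x \<partial>\<nu>)"
    unfolding \<nu> by (subst integral_distr) auto
qed

text \<open>The distance is at most the sum of the norms of the two coordinates, and these integrate
  to the first moments of the marginals.\<close>

lemma couplings_cost_finite:
  assumes "\<mu> \<in> P1" "\<nu> \<in> P1" and \<pi>: "\<pi> \<in> couplings \<mu> \<nu>"
  shows "(\<integral>\<^sup>+z. ennreal (dist (fst z) (snd z)) \<partial>\<pi>) < \<infinity>"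
proof -
  have "integrable \<pi> (\<lambda>z. norm (fst z))" "integrable \<pi> (\<lambda>z. norm (snd z))"
    using couplings_integral[OF \<pi> P1D(3) P1D(3)] assms by auto
  then have "integrable \<pi> (\<lambda>z. norm (fst z) + norm (snd z))"
    by simp
  then have "(\<integral>\<^sup>+z. ennreal (norm (norm (fst z) + norm (snd z))) \<partial>\<pi>) < \<infinity>"
    unfolding integrable_iff_bounded by blast
  moreover have "(\<integral>\<^sup>+z. ennreal (dist (fst z) (snd z)) \<partial>\<pi>)
      \<le> (\<integral>\<^sup>+z. ennreal (norm (norm (fst z) + norm (snd z))) \<partial>\<pi>)"
    by (intro nn_integral_mono ennreal_leI) (auto simp: dist_norm intro: norm_triangle_ineq4)
  ultimately show ?thesis
    by (rule le_less_trans[rotated])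
qed

text \<open>The easy half of Kantorovich-Rubinstein duality, for vector-valued \<open>h\<close>:
  under any coupling the difference of the integrals is the integral of
  \<open>h (fst z) - h (snd z)\<close>, hence at most \<open>L\<close> times the transport cost. The
  infimum over couplings is then taken.\<close>

lemma norm_integral_diff_le_W1:
  fixes h :: "'a::euclidean_space \<Rightarrow> 'b::{banach, second_countable_topology}"
  assumes P: "\<mu> \<in> P1" "\<nu> \<in> P1" and h: "L-lipschitz_on UNIV h"
  shows "norm ((\<integral>x. h x \<partial>\<mu>) - (\<integral>x. h x \<partial>\<nu>)) \<le> L * W1 \<mu> \<nu>"
proof -
  define cost where "cost \<pi> = (\<integral>\<^sup>+z. ennreal (dist (fst z) (snd z)) \<partial>\<pi>)"
    for \<pi> :: "('a \<times> 'a) measure"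
  define c where "c = norm ((\<integral>x. h x \<partial>\<mu>) - (\<integral>x. h x \<partial>\<nu>))"
  have L: "L \<ge> 0"
    by (rule lipschitz_on_nonneg[OF h])
  have meas: "h \<in> borel_measurable borel"
    using lipschitz_on_continuous_on[OF h] by (rule borel_measurable_continuous_onI)
  have int: "integrable \<mu> h" "integrable \<nu> h"
    using P h by (auto intro: P1_integrable_lipschitz)
  have fin: "cost \<pi> < \<infinity>" if "\<pi> \<in> couplings \<mu> \<nu>" for \<pi>
    unfolding cost_def using P that by (rule couplings_cost_finite)
  have bound: "c \<le> L * enn2real (cost \<pi>)" if \<pi>: "\<pi> \<in> couplings \<mu> \<nu>" for \<pi>
  proof -
    note I = couplings_integral[OF \<pi> int meas]
    have [measurable_cong]: "sets \<pi> = sets (borel \<Otimes>\<^sub>M borel)"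
      using \<pi> unfolding borel_prod by (simp add: couplings_def)
    have "ennreal c = ennreal (norm (\<integral>z. h (fst z) - h (snd z) \<partial>\<pi>))"
      using I by (simp add: c_def)
    also have "\<dots> \<le> (\<integral>\<^sup>+z. ennreal (norm (h (fst z) - h (snd z))) \<partial>\<pi>)"
      using I by (intro integral_norm_bound_ennreal) auto
    also have "\<dots> \<le> (\<integral>\<^sup>+z. ennreal L * ennreal (dist (fst z) (snd z)) \<partial>\<pi>)"
      using lipschitz_onD[OF h] L
      by (intro nn_integral_mono) (auto simp: dist_norm ennreal_mult[symmetric] intro!: ennreal_leI)
    also have "\<dots> = ennreal L * cost \<pi>"
      unfolding cost_def by (rule nn_integral_cmult) measurable
    also have "\<dots> = ennreal (L * enn2real (cost \<pi>))"
      using fin[OF \<pi>] L by (simp add: ennreal_mult)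
    finally show ?thesis
      using L by (simp add: ennreal_le_iff)
  qed
  have ne: "\<mu> \<Otimes>\<^sub>M \<nu> \<in> couplings \<mu> \<nu>"
    using P by (rule pair_measure_in_couplings)
  show ?thesis
  \<comment> \<open>Passing to the infimum requires dividing by \<open>L\<close>. For
    \<open>L = 0\<close> a single coupling already shows that the difference vanishes.\<close>
  proof (cases "L = 0")
    case True
    then show ?thesis
      using bound[OF ne] by (simp add: c_def)
  next
    case False
    with L have "L > 0"
      by simp
    have "ennreal (c / L) \<le> (INF \<pi>\<in>couplings \<mu> \<nu>. cost \<pi>)"
    proof (rule INF_greatest)
      fix \<pi> assume \<pi>: "\<pi> \<in> couplings \<mu> \<nu>"
      then have "c / L \<le> enn2real (cost \<pi>)"
        using bound[OF \<pi>] \<open>L > 0\<close> by (simp add: divide_simps mult_ac)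
      then have "ennreal (c / L) \<le> ennreal (enn2real (cost \<pi>))"
        by (rule ennreal_leI)
      also have "\<dots> = cost \<pi>"
        using fin[OF \<pi>] by simp
      finally show "ennreal (c / L) \<le> cost \<pi>" .
    qed
    \<comment> \<open>Finiteness is essential here: \<open>enn2real\<close> sends infinity to 0 and
      is monotone only below it.\<close>
    moreover have "(INF \<pi>\<in>couplings \<mu> \<nu>. cost \<pi>) < \<infinity>"
      using INF_lower[OF ne, of cost] fin[OF ne] by (rule le_less_trans)
    ultimately have "enn2real (ennreal (c / L)) \<le> W1 \<mu> \<nu>"
      unfolding W1_def cost_def[symmetric] by (intro enn2real_mono) auto
    moreover have "c / L \<ge> 0"
      using L by (simp add: c_def)
    ultimately show ?thesis
      using \<open>L > 0\<close> by (simp add: c_def[symmetric] divide_simps mult_ac)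
  qed
qed

section \<open>Integrability of the weight and lower bounds for the normalising constant\<close>

lemma continuous_on_gibbs_weight:
  assumes "continuous_on UNIV \<E>"
  shows "continuous_on UNIV (gibbs_weight \<E> n)"
proof -
  have "continuous_on UNIV (\<lambda>x. exp (- real n * \<E> x))"
    using assms by (intro continuous_intros)
  then show ?thesis
    by (simp add: gibbs_weight_def[abs_def])
qed

lemma gibbs_weight_pos: "gibbs_weight \<E> n x > 0"
  by (simp add: gibbs_weight_def)

lemma gibbs_weight_le_1: "0 \<le> \<E> x \<Longrightarrow> gibbs_weight \<E> n x \<le> 1"
  by (simp add: gibbs_weight_def)

lemma integrable_gibbs_weight:
  assumes "\<mu> \<in> P1" "continuous_on UNIV \<E>" "\<And>x. 0 \<le> \<E> x"
  shows "integrable \<mu> (gibbs_weight \<E> n)"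
  using assms(1) continuous_on_gibbs_weight[OF assms(2)]
  by (rule P1_integrable_linear_growth[where a = 1 and b = 0])
    (use assms(3) gibbs_weight_pos[of \<E> n] in \<open>auto simp: less_imp_le intro!: gibbs_weight_le_1\<close>)

lemma integrable_gibbs_weight_norm:
  fixes \<E> :: "'a::euclidean_space \<Rightarrow> real" and h :: "'a \<Rightarrow> 'b::real_normed_vector"
  assumes "\<mu> \<in> P1" and E: "continuous_on UNIV \<E>" "\<And>x. 0 \<le> \<E> x" and h: "L-lipschitz_on UNIV h"
  shows "integrable \<mu> (\<lambda>x. gibbs_weight \<E> n x * norm (h x))"
proof (rule P1_integrable_linear_growth[OF assms(1)])
  show "continuous_on UNIV (\<lambda>x. gibbs_weight \<E> n x * norm (h x))"
    by (intro continuous_intros continuous_on_gibbs_weight E lipschitz_on_continuous_on[OF h])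
  fix x
  have "norm (gibbs_weight \<E> n x * norm (h x)) \<le> norm (h x)"
    using gibbs_weight_le_1[of \<E> x n] E(2)[of x] gibbs_weight_pos[of \<E> n x]
    by (simp add: abs_mult mult_left_le_one_le)
  also have "\<dots> \<le> norm (h 0) + L * norm x"
    by (rule lipschitz_linear_growth[OF h])
  finally show "norm (gibbs_weight \<E> n x * norm (h x)) \<le> norm (h 0) + L * norm x" .
qed

text \<open>Markov's inequality in disguise: the weight dominates
  \<open>exp (- n C) * (1 - norm x / r)\<close> pointwise.\<close>

lemma integral_gibbs_weight_ge:
  assumes \<mu>: "\<mu> \<in> P1" and E: "continuous_on UNIV \<E>" "\<And>x. 0 \<le> \<E> x"
    and r: "r > 0" and C: "\<And>x. norm x \<le> r \<Longrightarrow> \<E> x \<le> C"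
  shows "exp (- (real n * C)) * (1 - m1 \<mu> / r) \<le> (\<integral>x. gibbs_weight \<E> n x \<partial>\<mu>)"
proof -
  interpret prob_space \<mu>
    by (rule P1D[OF \<mu>])
  have "exp (- (real n * C)) * (1 - m1 \<mu> / r) = (\<integral>x. exp (- (real n * C)) * (1 - norm x / r) \<partial>\<mu>)"
    using P1D(3)[OF \<mu>] by (simp add: m1_def prob_space)
  also have "\<dots> \<le> (\<integral>x. gibbs_weight \<E> n x \<partial>\<mu>)"
  proof (rule integral_mono)
    show "integrable \<mu> (\<lambda>x. exp (- (real n * C)) * (1 - norm x / r))"
      using P1D(3)[OF \<mu>] by auto
    show "integrable \<mu> (gibbs_weight \<E> n)"
      using \<mu> E by (rule integrable_gibbs_weight)
    fix x
    show "exp (- (real n * C)) * (1 - norm x / r) \<le> gibbs_weight \<E> n x"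
    proof (cases "norm x \<le> r")
      case True
      have "exp (- (real n * C)) * (1 - norm x / r) \<le> exp (- (real n * C)) * 1"
        using r by (intro mult_left_mono) auto
      also have "\<dots> \<le> gibbs_weight \<E> n x"
        using C[OF True] by (simp add: gibbs_weight_def mult_left_mono)
      finally show ?thesis .
    next
      case False
      then have "exp (- (real n * C)) * (1 - norm x / r) \<le> 0"
        using r by (intro mult_nonneg_nonpos) (auto simp: divide_simps)
      then show ?thesis
        using gibbs_weight_pos[of \<E> n x] by linarith
    qed
  qed
  finally show ?thesis .
qed

text \<open>Keeps the denominator of the mean away from 0 uniformly over a moment ball: a continuous
  energy is bounded on a compact ball, and a fixed share of the mass lies there. The bound may
  depend on \<open>n\<close> and \<open>R\<close>.\<close>

lemma integral_gibbs_weight_lower_bound: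
  fixes \<E> :: "'a::euclidean_space \<Rightarrow> real"
  assumes E: "continuous_on UNIV \<E>" "\<And>x. 0 \<le> \<E> x" and R: "R \<ge> 0"
  shows "\<exists>z>0. \<forall>\<mu>\<in>P1. m1 \<mu> \<le> R \<longrightarrow> z \<le> (\<integral>x. gibbs_weight \<E> n x \<partial>\<mu>)"
proof -
  \<comment> \<open>This radius makes the Markov factor \<open>1 - m1 \<mu> / r\<close> at least
    \<open>1 / 2\<close> whenever \<open>m1 \<mu> \<le> R\<close>.\<close>
  define r where "r = 2 * (1 + R)"
  have r: "r > 0"
    using R by (simp add: r_def)
  have "compact (\<E> ` cball 0 r)"
    by (intro compact_continuous_image continuous_on_subset[OF E(1)]) auto
  then obtain C where C: "\<And>x. norm x \<le> r \<Longrightarrow> \<E> x \<le> C"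
    using bounded_imp_bdd_above[OF compact_imp_bounded] by (fastforce simp: bdd_above_def)
  have "exp (- (real n * C)) * (1 / 2) \<le> (\<integral>x. gibbs_weight \<E> n x \<partial>\<mu>)"
    if "\<mu> \<in> P1" "m1 \<mu> \<le> R" for \<mu>
  proof -
    have "exp (- (real n * C)) * (1 / 2) \<le> exp (- (real n * C)) * (1 - m1 \<mu> / r)"
      using that r by (intro mult_left_mono) (auto simp: r_def divide_simps)
    also have "\<dots> \<le> (\<integral>x. gibbs_weight \<E> n x \<partial>\<mu>)"
      using that(1) E r C by (rule integral_gibbs_weight_ge)
    finally show ?thesis .
  qed
  then show ?thesis
    by (intro exI[of _ "exp (- (real n * C)) * (1 / 2)"]) auto
qed

lemma integral_gibbs_weight_pos:
  fixes \<E> :: "'a::euclidean_space \<Rightarrow> real"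
  assumes "\<mu> \<in> P1" "continuous_on UNIV \<E>" "\<And>x. 0 \<le> \<E> x"
  shows "(\<integral>x. gibbs_weight \<E> n x \<partial>\<mu>) > 0"
  using integral_gibbs_weight_lower_bound[OF assms(2,3) m1_nonneg[of \<mu>], of n] assms(1)
  by fastforce

section \<open>The linear growth bound, uniform in \<open>n\<close>\<close>

text \<open>Moving the norm inside the integral and clearing the positive denominator leaves only
  two real integrals to compare.\<close>

lemma norm_gibbs_mean_le:
  fixes \<E> :: "'a::euclidean_space \<Rightarrow> real"
  assumes \<mu>: "\<mu> \<in> P1" and E: "continuous_on UNIV \<E>" "\<And>x. 0 \<le> \<E> x"
    and le: "(\<integral>x. gibbs_weight \<E> n x * norm (g x) \<partial>\<mu>) \<le> F * (\<integral>x. gibbs_weight \<E> n x \<partial>\<mu>)"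
  shows "norm (gibbs_mean g \<E> n \<mu>) \<le> F"
proof -
  define Z where "Z = (\<integral>x. gibbs_weight \<E> n x \<partial>\<mu>)"
  have Z: "Z > 0"
    unfolding Z_def using \<mu> E by (rule integral_gibbs_weight_pos)
  have "norm (\<integral>x. gibbs_weight \<E> n x *\<^sub>R g x \<partial>\<mu>) \<le> (\<integral>x. norm (gibbs_weight \<E> n x *\<^sub>R g x) \<partial>\<mu>)"
    by (rule integral_norm_bound)
  also have "\<dots> \<le> F * Z"
    using le by (simp add: Z_def less_imp_le[OF gibbs_weight_pos])
  finally show ?thesis
    using Z by (simp add: gibbs_mean_def Z_def[symmetric] divide_simps mult_ac)
qed

text \<open>The mass of \<open>\<mu>\<close> within radius \<open>r = 2 (1 + m1 \<mu>)\<close> bounds the normalising constant from below by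
  \<open>exp (- n c3 (1 + r powr \<nu>)) / 2\<close>; the radius \<open>A\<close>, proportional to \<open>r\<close>, is chosen such that the
  weight outside it is at most \<open>exp (- n c3 (1 + r powr \<nu>))\<close>. Hence the bound does not depend on \<open>n\<close>.\<close>

lemma integral_gibbs_weight_norm_le:
  fixes \<E> :: "'a::euclidean_space \<Rightarrow> real"
  assumes \<mu>: "\<mu> \<in> P1" and E: "continuous_on UNIV \<E>"
    and c: "c2 > 0" "c3 > 0" "\<nu> > 0"
    and lower: "\<And>x. c2 * norm x powr \<nu> \<le> \<E> x"
    and upper: "\<And>x. \<E> x \<le> c3 * (1 + norm x powr \<nu>)"
  shows "(\<integral>x. gibbs_weight \<E> n x * norm x \<partial>\<mu>)
    \<le> (2 * (2 * c3 / c2) powr (1 / \<nu>) + 2) * (1 + m1 \<mu>) * (\<integral>x. gibbs_weight \<E> n x \<partial>\<mu>)"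
proof -
  interpret prob_space \<mu>
    by (rule P1D[OF \<mu>])
  define m where "m = m1 \<mu>"
  define r where "r = 2 * (1 + m)"
  \<comment> \<open>The factor is tuned so that
    \<open>c2 * A powr \<nu> = 2 * c3 * r powr \<nu>\<close>. Since \<open>r \<ge> 2\<close>, this
    dominates \<open>c3 * (1 + r powr \<nu>)\<close>, the upper bound of the energy on the ball of
    radius \<open>r\<close>.\<close>
  define A where "A = (2 * c3 / c2) powr (1 / \<nu>) * r"
  define Z where "Z = (\<integral>x. gibbs_weight \<E> n x \<partial>\<mu>)"
  define q where "q = exp (- (real n * (c3 * (1 + r powr \<nu>))))"
  have m: "m \<ge> 0"
    by (simp add: m_def m1_nonneg)
  have r: "r \<ge> 2"
    using m by (simp add: r_def)
  have A: "A \<ge> 0"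
    using r by (simp add: A_def)
  have E0: "0 \<le> \<E> x" for x
    using lower[of x] c(1) by (meson dual_order.trans less_imp_le mult_nonneg_nonneg powr_ge_zero)
  have "r powr \<nu> \<ge> 1"
    using r c by (intro ge_one_powr_ge_zero) auto
  then have "c3 * (1 + r powr \<nu>) \<le> c3 * (2 * r powr \<nu>)"
    using c by (intro mult_left_mono) auto
  also have "\<dots> = c2 * A powr \<nu>"
    using c r by (simp add: A_def powr_mult powr_powr)
  finally have A_ge: "c3 * (1 + r powr \<nu>) \<le> c2 * A powr \<nu>" .
  have "q * (1 / 2) \<le> q * (1 - m / r)"
    using m by (intro mult_left_mono) (auto simp: r_def q_def divide_simps)
  also have "\<dots> \<le> Z"
    unfolding q_def m_def Z_def
  proof (rule integral_gibbs_weight_ge[OF \<mu> E E0])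
    fix x :: 'a assume "norm x \<le> r"
    then have "c3 * (1 + norm x powr \<nu>) \<le> c3 * (1 + r powr \<nu>)"
      using c by (intro mult_left_mono add_left_mono powr_mono2) auto
    with upper[of x] show "\<E> x \<le> c3 * (1 + r powr \<nu>)"
      by linarith
  qed (use r in auto)
  finally have q_le: "q \<le> 2 * Z"
    by simp
  have pointwise: "gibbs_weight \<E> n x * norm x \<le> A * gibbs_weight \<E> n x + q * norm x" for x
  proof (cases "norm x \<le> A")
    case True
    then have "gibbs_weight \<E> n x * norm x \<le> A * gibbs_weight \<E> n x"
      using gibbs_weight_pos[of \<E> n x] by (simp add: mult_right_mono mult.commute)
    moreover have "q * norm x \<ge> 0"
      by (simp add: q_def)
    ultimately show ?thesis
      by linarith
  next
    case False
    then have "c2 * A powr \<nu> \<le> c2 * norm x powr \<nu>"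
      using A c by (intro mult_left_mono powr_mono2) auto
    with A_ge lower[of x] have "c3 * (1 + r powr \<nu>) \<le> \<E> x"
      by linarith
    then have "gibbs_weight \<E> n x \<le> q"
      by (simp add: gibbs_weight_def q_def mult_left_mono)
    then have "gibbs_weight \<E> n x * norm x \<le> q * norm x"
      by (simp add: mult_right_mono)
    moreover have "A * gibbs_weight \<E> n x \<ge> 0"
      using A gibbs_weight_pos[of \<E> n x] by simp
    ultimately show ?thesis
      by linarith
  qed
  have int_w: "integrable \<mu> (gibbs_weight \<E> n)"
    using \<mu> E E0 by (rule integrable_gibbs_weight)
  have int_wx: "integrable \<mu> (\<lambda>x. gibbs_weight \<E> n x * norm x)"
    using \<mu> E E0 lipschitz_on_id by (rule integrable_gibbs_weight_norm)
  have "(\<integral>x. gibbs_weight \<E> n x * norm x \<partial>\<mu>) \<le> (\<integral>x. A * gibbs_weight \<E> n x + q * norm x \<partial>\<mu>)"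
    using int_w int_wx P1D(3)[OF \<mu>] pointwise by (intro integral_mono) auto
  also have "\<dots> = A * Z + q * m"
    using int_w P1D(3)[OF \<mu>] by (simp add: Z_def m_def m1_def)
  \<comment> \<open>Trading \<open>q\<close> for \<open>2 * Z\<close> makes both terms multiples of
    \<open>Z\<close>, with coefficients free of \<open>n\<close>.\<close>
  also have "\<dots> \<le> A * Z + 2 * Z * m"
    using q_le m by (intro add_left_mono mult_right_mono)
  also have "\<dots> \<le> A * Z + 2 * Z * (1 + m)"
    using integral_gibbs_weight_pos[OF \<mu> E E0, of n] by (simp add: Z_def)
  also have "\<dots> = (2 * (2 * c3 / c2) powr (1 / \<nu>) + 2) * (1 + m) * Z"
    by (simp add: A_def r_def algebra_simps)
  finally show ?thesis
    by (simp add: m_def Z_def)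
qed

text \<open>Under \<open>growth_i\<close>, the bound
  \<open>norm (g x) \<le> norm (g 0) + K * norm x\<close> reduces the claim to the weighted first
  moment. Under \<open>growth_ii\<close>, the mean is a weighted average of a bounded
  function.\<close>

lemma gibbs_mean_growth:
  fixes \<E> :: "'a::euclidean_space \<Rightarrow> real"
  assumes E: "continuous_on UNIV \<E>" "\<And>x. 0 \<le> \<E> x"
    and g: "K-lipschitz_on UNIV g"
    and growth: "growth_i \<E> \<or> growth_ii g \<E>"
  shows "\<exists>M\<ge>0. \<forall>n. cond_f2_with M (gibbs_mean g \<E> n)"
  using growth
proof
  have K: "K \<ge> 0"
    by (rule lipschitz_on_nonneg[OF g])
  assume "growth_i \<E>"
  then obtain c2 c3 \<nu> where c: "c2 > 0" "c3 > 0" "\<nu> > 0"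
    and lower: "\<And>x. c2 * norm x powr \<nu> \<le> \<E> x"
    and upper: "\<And>x. \<E> x \<le> c3 * (1 + norm x powr \<nu>)"
    unfolding growth_i_def by blast
  define D where "D = 2 * (2 * c3 / c2) powr (1 / \<nu>) + 2"
  have D: "D \<ge> 0"
    by (simp add: D_def)
  have "norm (gibbs_mean g \<E> n \<mu>) \<le> (norm (g 0) + K * D) * (1 + m1 \<mu>)" if \<mu>: "\<mu> \<in> P1" for n \<mu>
  proof (rule norm_gibbs_mean_le[OF \<mu> E])
    define Z where "Z = (\<integral>x. gibbs_weight \<E> n x \<partial>\<mu>)"
    have Z: "Z > 0"
      unfolding Z_def using \<mu> E by (rule integral_gibbs_weight_pos)
    have int_w: "integrable \<mu> (gibbs_weight \<E> n)"
      using \<mu> E by (rule integrable_gibbs_weight)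
    have int_wg: "integrable \<mu> (\<lambda>x. gibbs_weight \<E> n x * norm (g x))"
      using \<mu> E g by (rule integrable_gibbs_weight_norm)
    have int_wx: "integrable \<mu> (\<lambda>x. gibbs_weight \<E> n x * norm x)"
      using \<mu> E lipschitz_on_id by (rule integrable_gibbs_weight_norm)
    have "(\<integral>x. gibbs_weight \<E> n x * norm (g x) \<partial>\<mu>)
        \<le> (\<integral>x. norm (g 0) * gibbs_weight \<E> n x + K * (gibbs_weight \<E> n x * norm x) \<partial>\<mu>)"
    proof (rule integral_mono)
      fix x
      have "gibbs_weight \<E> n x * norm (g x) \<le> gibbs_weight \<E> n x * (norm (g 0) + K * norm x)"
        using gibbs_weight_pos[of \<E> n x] lipschitz_linear_growth[OF g, of x]
        by (intro mult_left_mono) auto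
      then show "gibbs_weight \<E> n x * norm (g x)
          \<le> norm (g 0) * gibbs_weight \<E> n x + K * (gibbs_weight \<E> n x * norm x)"
        by (simp add: algebra_simps)
    qed (use int_w int_wg int_wx in auto)
    also have "\<dots> = norm (g 0) * Z + K * (\<integral>x. gibbs_weight \<E> n x * norm x \<partial>\<mu>)"
      using int_w int_wx by (simp add: Z_def)
    also have "\<dots> \<le> norm (g 0) * Z + K * (D * (1 + m1 \<mu>) * Z)"
      unfolding Z_def D_def
      using K integral_gibbs_weight_norm_le[OF \<mu> E(1) c lower upper, of n]
      by (intro add_left_mono mult_left_mono)
    also have "\<dots> \<le> norm (g 0) * (1 + m1 \<mu>) * Z + K * (D * (1 + m1 \<mu>) * Z)"
      using Z m1_nonneg[of \<mu>] by (intro add_right_mono mult_right_mono) (auto simp: algebra_simps)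
    also have "\<dots> = (norm (g 0) + K * D) * (1 + m1 \<mu>) * Z"
      by (simp add: algebra_simps)
    finally show "(\<integral>x. gibbs_weight \<E> n x * norm (g x) \<partial>\<mu>)
        \<le> (norm (g 0) + K * D) * (1 + m1 \<mu>) * (\<integral>x. gibbs_weight \<E> n x \<partial>\<mu>)"
      by (simp add: Z_def)
  qed
  then show ?thesis
    using K D by (intro exI[of _ "norm (g 0) + K * D"]) (auto simp: cond_f2_with_def)
next
  assume "growth_ii g \<E>"
  then obtain G where G: "\<And>x. norm (g x) \<le> G"
    unfolding growth_ii_def bounded_iff by blast
  have G0: "G \<ge> 0"
    using G[of 0] norm_ge_zero order_trans by blast
  have "norm (gibbs_mean g \<E> n \<mu>) \<le> G * (1 + m1 \<mu>)" if \<mu>: "\<mu> \<in> P1" for n \<mu>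
  proof -
    have "norm (gibbs_mean g \<E> n \<mu>) \<le> G"
    proof (rule norm_gibbs_mean_le[OF \<mu> E])
      have int_w: "integrable \<mu> (gibbs_weight \<E> n)"
        using \<mu> E by (rule integrable_gibbs_weight)
      have "(\<integral>x. gibbs_weight \<E> n x * norm (g x) \<partial>\<mu>) \<le> (\<integral>x. G * gibbs_weight \<E> n x \<partial>\<mu>)"
        using int_w G G0 gibbs_weight_pos[of \<E> n]
        by (intro integral_mono') (auto simp: mult.commute less_imp_le intro!: mult_right_mono)
      then show "(\<integral>x. gibbs_weight \<E> n x * norm (g x) \<partial>\<mu>) \<le> G * (\<integral>x. gibbs_weight \<E> n x \<partial>\<mu>)"
        by simp
    qed
    also have "G \<le> G * (1 + m1 \<mu>)"
      using G0 m1_nonneg[of \<mu>] by (simp add: algebra_simps)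
    finally show ?thesis .
  qed
  then show ?thesis
    using G0 by (intro exI[of _ G]) (auto simp: cond_f2_with_def)
qed

section \<open>Lipschitz continuity of the weighted integrands for fixed \<open>n\<close>\<close>

text \<open>The vector is the gradient of the weight. The factor \<open>1 + norm x\<close> leaves
  room for a linearly growing \<open>g\<close>; the lower power bound on the energy supplies the
  decay.\<close>

lemma gibbs_weight_gradient_bounded:
  fixes \<E> :: "'a::euclidean_space \<Rightarrow> real"
  assumes c1: "c1 > 0" "\<gamma> > 0" "\<And>x. norm (grad\<E> x) \<le> c1 * (1 + norm x powr \<gamma>)"
    and c2: "c2 > 0" "\<nu> > 0" "\<And>x. c2 * norm x powr \<nu> \<le> \<E> x"
  shows "\<exists>B. \<forall>x. norm ((- real n * gibbs_weight \<E> n x) *\<^sub>R grad\<E> x) * (1 + norm x) \<le> B"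
\<comment> \<open>For \<open>n = 0\<close> the weight is constant and does not decay, but the factor
  \<open>n\<close> makes its gradient vanish.\<close>
proof (cases "n = 0")
  case True
  then show ?thesis
    by auto
next
  case False
  then obtain B where B:
    "\<And>t. t \<ge> 0 \<Longrightarrow> (1 + t powr \<gamma>) * (1 + t) * exp (- (real n * c2 * t powr \<nu>)) \<le> B"
    using powr_mult_exp_powr_bounded[of \<gamma> "real n * c2" \<nu>] c1(2) c2(1,2) by auto
  have "norm ((- real n * gibbs_weight \<E> n x) *\<^sub>R grad\<E> x) * (1 + norm x) \<le> real n * c1 * B" for x
  proof -
    have w: "gibbs_weight \<E> n x \<le> exp (- (real n * c2 * norm x powr \<nu>))"
      using mult_left_mono[OF c2(3)[of x], of "real n"] by (simp add: gibbs_weight_def mult.assoc)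
    have "norm ((- real n * gibbs_weight \<E> n x) *\<^sub>R grad\<E> x) * (1 + norm x)
        = real n * gibbs_weight \<E> n x * norm (grad\<E> x) * (1 + norm x)"
      using gibbs_weight_pos[of \<E> n x] by (simp add: abs_mult)
    also have "\<dots> \<le> real n * exp (- (real n * c2 * norm x powr \<nu>))
        * (c1 * (1 + norm x powr \<gamma>)) * (1 + norm x)"
      using w c1 gibbs_weight_pos[of \<E> n x]
      by (intro mult_right_mono mult_mono mult_left_mono) auto
    also have "\<dots> = real n * c1 * ((1 + norm x powr \<gamma>) * (1 + norm x) * exp (- (real n * c2 * norm x powr \<nu>)))"
      by (simp add: mult_ac)
    also have "\<dots> \<le> real n * c1 * B"
      using B[of "norm x"] c1(1) by (intro mult_left_mono) auto
    finally show ?thesis .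
  qed
  then show ?thesis
    by blast
qed

lemma GDERIV_gibbs_weight:
  assumes "GDERIV \<E> x :> e"
  shows "GDERIV (gibbs_weight \<E> n) x :> (- real n * gibbs_weight \<E> n x) *\<^sub>R e"
proof -
  have "((\<lambda>t. exp (- real n * t)) has_field_derivative - real n * exp (- real n * \<E> x)) (at (\<E> x))"
    by (auto intro!: derivative_eq_intros)
  from GDERIV_DERIV_compose[OF assms this] show ?thesis
    by (simp add: gibbs_weight_def[abs_def])
qed

text \<open>A Lipschitz \<open>g\<close> satisfies
  \<open>norm (g x) \<le> (norm (g 0) + K) * (1 + norm x)\<close>, so the weighted gradient bound
  controls the product. The codomain of \<open>g\<close> is kept general so that the constant
  function 1 recovers the weight itself.\<close>

lemma gibbs_weight_scaleR_lipschitz: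
  fixes \<E> :: "'a::euclidean_space \<Rightarrow> real" and g :: "'a \<Rightarrow> 'b::real_normed_vector"
  assumes E: "\<And>x. 0 \<le> \<E> x" "\<And>x. GDERIV \<E> x :> grad\<E> x"
    and B: "\<And>x. norm ((- real n * gibbs_weight \<E> n x) *\<^sub>R grad\<E> x) * (1 + norm x) \<le> B"
    and g: "K-lipschitz_on UNIV g"
  shows "\<exists>L. L-lipschitz_on UNIV (\<lambda>x. gibbs_weight \<E> n x *\<^sub>R g x)"
proof -
  let ?C = "norm (g 0) + K"
  have K: "K \<ge> 0"
    by (rule lipschitz_on_nonneg[OF g])
  have "(K + ?C * B + 1)-lipschitz_on UNIV (\<lambda>x. gibbs_weight \<E> n x *\<^sub>R g x)"
  proof (rule lipschitz_scaleR_GDERIV[OF GDERIV_gibbs_weight[OF E(2)] _ g])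
    show "\<bar>gibbs_weight \<E> n x\<bar> \<le> 1" for x
      using gibbs_weight_pos[of \<E> n x] gibbs_weight_le_1[of \<E> x n] E(1)[of x] by simp
    fix x
    let ?d = "norm ((- real n * gibbs_weight \<E> n x) *\<^sub>R grad\<E> x)"
    have "norm (g x) \<le> norm (g 0) + K * norm x"
      by (rule lipschitz_linear_growth[OF g])
    also have "\<dots> \<le> ?C * (1 + norm x)"
      using K by (simp add: algebra_simps)
    finally have "?d * norm (g x) \<le> ?d * (?C * (1 + norm x))"
      by (rule mult_left_mono) simp
    also have "\<dots> = ?C * (?d * (1 + norm x))"
      by (simp only: mult_ac)
    also have "\<dots> \<le> ?C * B"
      using B[of x] K by (intro mult_left_mono) auto
    finally show "?d * norm (g x) \<le> ?C * B" .
  qed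
  then show ?thesis ..
qed

section \<open>Local Lipschitz continuity of the mean, and conclusion\<close>

text \<open>With numerators \<open>H\<close>, denominators \<open>Z\<close> and \<open>F\<close> the
  mean at \<open>\<mu>2\<close>, the difference of the means is
  \<open>H \<mu>1 - H \<mu>2 - (Z \<mu>1 - Z \<mu>2) *\<^sub>R F\<close> divided by
  \<open>Z \<mu>1\<close>. Both differences are controlled by \<open>W1\<close>, the denominator is
  at least \<open>z\<close>, and the growth bound enters to estimate \<open>F\<close> by
  \<open>M * (1 + R)\<close>.\<close>

lemma gibbs_mean_cond_f1:
  fixes \<E> :: "'a::euclidean_space \<Rightarrow> real"
  assumes E: "continuous_on UNIV \<E>" "\<And>x. 0 \<le> \<E> x"
    and w: "Lw-lipschitz_on UNIV (gibbs_weight \<E> n)"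
    and wg: "Lg-lipschitz_on UNIV (\<lambda>x. gibbs_weight \<E> n x *\<^sub>R g x)"
    and M: "M \<ge> 0" "cond_f2_with M (gibbs_mean g \<E> n)"
  shows "cond_f1 (gibbs_mean g \<E> n)"
  unfolding cond_f1_def
proof (intro allI impI)
  fix R :: real
  assume "R > 0"
  then obtain z where z: "z > 0"
    "\<And>\<mu>. \<mu> \<in> P1 \<Longrightarrow> m1 \<mu> \<le> R \<Longrightarrow> z \<le> (\<integral>x. gibbs_weight \<E> n x \<partial>\<mu>)"
    using integral_gibbs_weight_lower_bound[OF E, of R n] by auto
  define L where "L = (Lg + M * (1 + R) * Lw) / z"
  have Lip: "Lw \<ge> 0" "Lg \<ge> 0"
    using w wg by (auto dest: lipschitz_on_nonneg)
  have L: "L \<ge> 0"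
    using Lip M z \<open>R > 0\<close> by (simp add: L_def)
  \<comment> \<open>\<open>L\<close> itself may be 0, whereas \<open>cond_f1\<close> asks for a
    strictly positive constant; hence \<open>L + 1\<close>.\<close>
  have "norm (gibbs_mean g \<E> n \<mu>1 - gibbs_mean g \<E> n \<mu>2) \<le> (L + 1) * W1 \<mu>1 \<mu>2"
    if P: "\<mu>1 \<in> P1" "\<mu>2 \<in> P1" and R: "m1 \<mu>1 \<le> R" "m1 \<mu>2 \<le> R" for \<mu>1 \<mu>2
  proof -
    define Z where "Z \<mu> = (\<integral>x. gibbs_weight \<E> n x \<partial>\<mu>)" for \<mu>
    define H where "H \<mu> = (\<integral>x. gibbs_weight \<E> n x *\<^sub>R g x \<partial>\<mu>)" for \<mu>
    define F where "F = gibbs_mean g \<E> n \<mu>2"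
    have W: "W1 \<mu>1 \<mu>2 \<ge> 0"
      by (simp add: W1_def)
    have Z1: "z \<le> Z \<mu>1" and Z2: "z \<le> Z \<mu>2"
      unfolding Z_def using z(2) P R by auto
    have "Z \<mu>2 *\<^sub>R F = H \<mu>2"
      using Z2 z(1) by (simp add: F_def gibbs_mean_def Z_def H_def)
    then have "gibbs_mean g \<E> n \<mu>1 - F = (1 / Z \<mu>1) *\<^sub>R (H \<mu>1 - H \<mu>2 - (Z \<mu>1 - Z \<mu>2) *\<^sub>R F)"
      using Z1 z(1) by (simp add: gibbs_mean_def[of g \<E> n \<mu>1] Z_def[symmetric] H_def[symmetric] scaleR_diff_right scaleR_diff_left)
    then have "norm (gibbs_mean g \<E> n \<mu>1 - F) = norm (H \<mu>1 - H \<mu>2 - (Z \<mu>1 - Z \<mu>2) *\<^sub>R F) / Z \<mu>1"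
      using Z1 z(1) by simp
    also have "\<dots> \<le> norm (H \<mu>1 - H \<mu>2 - (Z \<mu>1 - Z \<mu>2) *\<^sub>R F) / z"
      using Z1 z(1) by (intro divide_left_mono) auto
    also have "\<dots> \<le> (norm (H \<mu>1 - H \<mu>2) + norm (Z \<mu>1 - Z \<mu>2) * norm F) / z"
      using z(1) norm_triangle_ineq4[of "H \<mu>1 - H \<mu>2" "(Z \<mu>1 - Z \<mu>2) *\<^sub>R F"]
      by (intro divide_right_mono) auto
    also have "\<dots> \<le> (Lg * W1 \<mu>1 \<mu>2 + Lw * W1 \<mu>1 \<mu>2 * (M * (1 + R))) / z"
    proof (intro divide_right_mono add_mono mult_mono)
      show "norm (H \<mu>1 - H \<mu>2) \<le> Lg * W1 \<mu>1 \<mu>2"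
        unfolding H_def using P wg by (rule norm_integral_diff_le_W1)
      show "norm (Z \<mu>1 - Z \<mu>2) \<le> Lw * W1 \<mu>1 \<mu>2"
        unfolding Z_def using P w by (rule norm_integral_diff_le_W1)
      have "norm F \<le> M * (1 + m1 \<mu>2)"
        unfolding F_def using M(2) P(2) by (simp add: cond_f2_with_def)
      also have "\<dots> \<le> M * (1 + R)"
        using M(1) R(2) by (intro mult_left_mono) auto
      finally show "norm F \<le> M * (1 + R)" .
    qed (use W Lip z(1) in auto)
    also have "\<dots> = L * W1 \<mu>1 \<mu>2"
      by (simp add: L_def algebra_simps)
    also have "\<dots> \<le> (L + 1) * W1 \<mu>1 \<mu>2"
      using W by (simp add: algebra_simps)
    finally show ?thesis
      by (simp add: F_def)
  qed
  then show "\<exists>L>0. \<forall>\<mu>1\<in>P1. \<forall>\<mu>2\<in>P1. m1 \<mu>1 \<le> R \<longrightarrow> m1 \<mu>2 \<le> R \<longrightarrow>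
     norm (gibbs_mean g \<E> n \<mu>1 - gibbs_mean g \<E> n \<mu>2) \<le> L * W1 \<mu>1 \<mu>2"
    using L by (intro exI[of _ "L + 1"]) auto
qed

theorem proposition5p1:
  fixes g :: "real ^ 'd \<Rightarrow> real ^ 'd"
    and \<E> :: "real ^ 'd \<Rightarrow> real"
    and grad\<E> :: "real ^ 'd \<Rightarrow> real ^ 'd"
  assumes dim: "CARD('d) > 1"
    and g_lipschitz: "\<exists>K. K-lipschitz_on UNIV g"
    and E_nonneg: "\<And>x. 0 \<le> \<E> x"
    and E_gradient: "\<And>x. GDERIV \<E> x :> grad\<E> x"
    and E_C1: "continuous_on UNIV grad\<E>"
    and E_min: "\<And>x. \<E> 0 \<le> \<E> x"
    and gradient_growth: "\<exists>c1>0. \<exists>\<gamma>>0. \<forall>x. norm (grad\<E> x) \<le> c1 * (1 + norm x powr \<gamma>)"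
    and growth: "growth_i \<E> \<or> growth_ii g \<E>"
  shows "\<exists>M\<ge>0.
      (\<forall>n::nat. \<forall>R>0. \<exists>L>0. \<forall>\<mu>\<in>P1. \<forall>\<mu>1\<in>P1. \<forall>\<mu>2\<in>P1. m1 \<mu>1 \<le> R \<longrightarrow> m1 \<mu>2 \<le> R \<longrightarrow>
         norm (gibbs_mean g \<E> n \<mu>1 - gibbs_mean g \<E> n \<mu>2) \<le> L * W1 \<mu>1 \<mu>2 \<and>
         norm (gibbs_mean g \<E> n \<mu>) \<le> M * (1 + m1 \<mu>)) \<and>
      (\<forall>n. cond_f1 (gibbs_mean g \<E> n) \<and> cond_f2 (gibbs_mean g \<E> n)) \<and>
      (\<forall>n. cond_f2_with M (gibbs_mean g \<E> n))"
proof -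
  obtain K where K: "K-lipschitz_on UNIV g"
    using g_lipschitz by blast
  obtain c1 \<gamma> where c1: "c1 > 0" "\<gamma> > 0" "\<And>x. norm (grad\<E> x) \<le> c1 * (1 + norm x powr \<gamma>)"
    using gradient_growth by blast
  \<comment> \<open>Both growth alternatives contain this lower bound, so the Lipschitz part
    proceeds without a case distinction.\<close>
  obtain c2 \<nu> where c2: "c2 > 0" "\<nu> > 0" "\<And>x. c2 * norm x powr \<nu> \<le> \<E> x"
    using growth unfolding growth_i_def growth_ii_def by blast
  have cont: "continuous_on UNIV \<E>"
    using E_gradient unfolding gderiv_def
    by (intro continuous_at_imp_continuous_on) (blast intro: has_derivative_continuous)
  obtain M where M: "M \<ge> 0" "\<And>n. cond_f2_with M (gibbs_mean g \<E> n)"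
    using gibbs_mean_growth[OF cont E_nonneg K growth] by blast
  have f1: "cond_f1 (gibbs_mean g \<E> n)" for n
  proof -
    obtain B where B: "\<And>x. norm ((- real n * gibbs_weight \<E> n x) *\<^sub>R grad\<E> x) * (1 + norm x) \<le> B"
      using gibbs_weight_gradient_bounded[where n = n, OF c1 c2] by blast
    note lip = gibbs_weight_scaleR_lipschitz[OF E_nonneg E_gradient B]
    obtain Lg where Lg: "Lg-lipschitz_on UNIV (\<lambda>x. gibbs_weight \<E> n x *\<^sub>R g x)"
      using lip[OF K] by blast
    \<comment> \<open>The constant function 1 in place of \<open>g\<close> turns the weighted
      integrand into the weight.\<close>
    have "0-lipschitz_on UNIV (\<lambda>x::real ^ 'd. 1 :: real)"
      by (rule lipschitz_on_constant)
    from lip[OF this] obtain Lw where "Lw-lipschitz_on UNIV (gibbs_weight \<E> n)"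
      by auto
    from gibbs_mean_cond_f1[OF cont E_nonneg this Lg M] show ?thesis .
  qed
  have "\<exists>L>0. \<forall>\<mu>\<in>P1. \<forall>\<mu>1\<in>P1. \<forall>\<mu>2\<in>P1. m1 \<mu>1 \<le> R \<longrightarrow> m1 \<mu>2 \<le> R \<longrightarrow>
      norm (gibbs_mean g \<E> n \<mu>1 - gibbs_mean g \<E> n \<mu>2) \<le> L * W1 \<mu>1 \<mu>2 \<and>
      norm (gibbs_mean g \<E> n \<mu>) \<le> M * (1 + m1 \<mu>)" if "R > 0" for n and R :: real
    using f1[of n, unfolded cond_f1_def, rule_format, OF that] M(2)[of n, unfolded cond_f2_with_def]
    by blast
  moreover have "cond_f2 (gibbs_mean g \<E> n)" for n
    using M unfolding cond_f2_def by blast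
  ultimately show ?thesis
    using M f1 by blast
qed

end
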